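(* Let $(\mathfrak g,\{-,\cdots,-\})$ be an $n$-pre-Lie algebra and define the skew-symmetric multilinear map $L:\wedge^{n-1}\mathfrak g\to\mathfrak{gl}(\mathfrak g)$ by $L(x_1,\cdots,x_{n-1})(x_n)=\{x_1,\cdots,x_{n-1},x_n\}$ for all $x_1,\cdots,x_n\in\mathfrak g$. Then $(\mathfrak g;L)$ is a representation of the $n$-Lie algebra $(\mathfrak g,[-,\cdots,-]_C)$.
   Context: All vector spaces are finite dimensional over an algebraically closed field of characteristic $0$; $n\ge2$; a hat denotes omission. An $n$-Lie algebra is a vector space $\mathfrak g$ with a skew-symmetric linear map $[-,\cdots,-]_{\mathfrak g}:\wedge^n\mathfrak g\to\mathfrak g$ such that $[x_1,\cdots,x_{n-1},[y_1,\cdots,y_n]]=\sum_{i=1}^n[y_1,\cdots,y_{i-1},[x_1,\cdots,x_{n-1},y_i],y_{i+1},\cdots,y_n]$. A representation of it on $V$ is a linear map $\rho:\wedge^{n-1}\mathfrak g\to\mathfrak{gl}(V)$ with (i) $[\rho(\mathfrak X),\rho(\mathfrak Y)]=\rho(\mathfrak X\circ\mathfrak Y)$ (commutator on the left), where for $\mathfrak X=x_1\wedge\cdots\wedge x_{n-1}$, $\mathfrak Y=y_1\wedge\cdots\wedge y_{n-1}$, $\mathfrak X\circ\mathfrak Y=\sum_{i=1}^{n-1}y_1\wedge\cdots\wedge[x_1,\cdots,x_{n-1},y_i]_{\mathfrak g}\wedge\cdots\wedge y_{n-1}$; and (ii) $\rho(x_1,\cdots,x_{n-2},[y_1,\cdots,y_n]_{\mathfrak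 g})=\sum_{i=1}^n(-1)^{n-i}\rho(y_1,\cdots,\widehat{y_i},\cdots,y_n)\rho(x_1,\cdots,x_{n-2},y_i)$. An $n$-pre-Lie algebra is a vector space $\mathfrak g$ with a multilinear map $\{-,\cdots,-\}:\wedge^{n-1}\mathfrak g\otimes\mathfrak g\to\mathfrak g$ such that for all $x_i,y_j\in\mathfrak g$: (1) $\{x_1,\cdots,x_{n-1},\{y_1,\cdots,y_{n-1},y_n\}\}=\sum_{i=1}^{n-1}\{y_1,\cdots,y_{i-1},[x_1,\cdots,x_{n-1},y_i]_C,y_{i+1},\cdots,y_n\}+\{y_1,\cdots,y_{n-1},\{x_1,\cdots,x_{n-1},y_n\}\}$; (2) $\{[y_1,\cdots,y_n]_C,x_1,\cdots,x_{n-2},x_{n-1}\}=\sum_{i=1}^n(-1)^{n-i}\{y_1,\cdots,\widehat{y_i},\cdots,y_n,\{y_i,x_1,\cdots,x_{n-2},x_{n-1}\}\}$, where $[x_1,\cdots,x_n]_C=\sum_{i=1}^n(-1)^{n-i}\{x_1,\cdots,\widehat{x_i},\cdots,x_n,x_i\}$. The bracket $[-,\cdots,-]_C$ is an $n$-Lie bracket on $\mathfrak g$; $(\mathfrak g,[-,\cdots,-]_C)$ is called the sub-adjacent $n$-Lie algebra. *)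

theory Defs
  imports Complex_Main "HOL-Computational_Algebra.Polynomial"
begin

text \<open>
  An \<open>m\<close>-tuple is a list of length \<open>m\<close>; nothing is required of the maps below on lists of other
  lengths. Positions are counted from \<open>0\<close>, so the sign \<open>(-1)\<^sup>n\<^sup>-\<^sup>i\<close> attached to the \<open>i\<close>-th of \<open>n\<close>
  entries (counted from \<open>1\<close>) becomes \<open>(-1) ^ (n - Suc i)\<close>. A vector space is a whole type, with
  its scalar multiplication as a parameter.
\<close>

locale fd_vector_space = vector_space scale
  for scale :: "'k::{alg_closed_field, field_char_0} \<Rightarrow> 'v::ab_group_add \<Rightarrow> 'v" +
  assumes finite_dimensional: "\<exists>B. finite B \<and> span B = UNIV"

definition omit :: "nat \<Rightarrow> 'a list \<Rightarrow> 'a list" where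
  "omit i xs = take i xs @ drop (Suc i) xs"

definition multilinear_map ::
  "('k::field \<Rightarrow> 'a::ab_group_add \<Rightarrow> 'a) \<Rightarrow> ('k \<Rightarrow> 'b::ab_group_add \<Rightarrow> 'b) \<Rightarrow> nat \<Rightarrow>
    ('a list \<Rightarrow> 'b) \<Rightarrow> bool" where
  "multilinear_map scaleA scaleB m f \<longleftrightarrow>
    (\<forall>xs i. length xs = m \<longrightarrow> i < m \<longrightarrow>
      Vector_Spaces.linear scaleA scaleB (\<lambda>x. f (xs[i := x])))"

definition skew_symmetric :: "nat \<Rightarrow> ('a list \<Rightarrow> 'b::ab_group_add) \<Rightarrow> bool" where
  "skew_symmetric m f \<longleftrightarrow>
    (\<forall>xs i j. length xs = m \<longrightarrow> i < m \<longrightarrow> j < m \<longrightarrow> i \<noteq> j \<longrightarrow>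
      f (xs[i := xs ! j, j := xs ! i]) = - f xs)"

text \<open>
  In characteristic \<open>0\<close>, the linear maps on the \<open>m\<close>-th exterior power are the skew-symmetric
  \<open>m\<close>-linear maps.
\<close>

locale n_lie_algebra = fd_vector_space scale
  for scale :: "'k::{alg_closed_field, field_char_0} \<Rightarrow> 'v::ab_group_add \<Rightarrow> 'v" +
  fixes n :: nat
    and bracket :: "'v list \<Rightarrow> 'v"
  assumes n_ge_2: "2 \<le> n"
    and bracket_multilinear: "multilinear_map scale scale n bracket"
    and bracket_skew: "skew_symmetric n bracket"
    and fundamental_identity:
      "\<And>xs ys. length xs = n - 1 \<Longrightarrow> length ys = n \<Longrightarrow>
        bracket (xs @ [bracket ys]) = (\<Sum>i<n. bracket (ys[i := bracket (xs @ [ys ! i])]))"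

text \<open>
  A map into \<open>\<gg>\<ll>(V)\<close> is a function whose values are linear operators; its multilinearity and
  skew-symmetry are stated pointwise on \<open>V\<close>. The right-hand side of \<open>rho_commutator\<close> is \<open>\<rho>\<close>,
  extended linearly, at the sum of wedge products
  \<open>\<Sum>i. y\<^sub>1 \<and> \<dots> \<and> [x\<^sub>1, \<dots>, x\<^sub>n\<^sub>-\<^sub>1, y\<^sub>i] \<and> \<dots> \<and> y\<^sub>n\<^sub>-\<^sub>1\<close>.
\<close>

locale n_lie_representation =
  n_lie_algebra scale n bracket + V: fd_vector_space scaleV
  for scale :: "'k::{alg_closed_field, field_char_0} \<Rightarrow> 'v::ab_group_add \<Rightarrow> 'v"
    and n :: nat
    and bracket :: "'v list \<Rightarrow> 'v"
    and scaleV :: "'k \<Rightarrow> 'w::ab_group_add \<Rightarrow> 'w" +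
  fixes rho :: "'v list \<Rightarrow> 'w \<Rightarrow> 'w"
  assumes rho_linear:
      "\<And>xs. length xs = n - 1 \<Longrightarrow> Vector_Spaces.linear scaleV scaleV (rho xs)"
    and rho_multilinear: "\<And>w. multilinear_map scale scaleV (n - 1) (\<lambda>xs. rho xs w)"
    and rho_skew: "\<And>w. skew_symmetric (n - 1) (\<lambda>xs. rho xs w)"
    and rho_commutator:
      "\<And>xs ys w. length xs = n - 1 \<Longrightarrow> length ys = n - 1 \<Longrightarrow>
        rho xs (rho ys w) - rho ys (rho xs w) =
          (\<Sum>i<n - 1. rho (ys[i := bracket (xs @ [ys ! i])]) w)"
    and rho_bracket:
      "\<And>xs ys w. length xs = n - 2 \<Longrightarrow> length ys = n \<Longrightarrow>
        rho (xs @ [bracket ys]) w =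
          (\<Sum>i<n. scaleV ((-1) ^ (n - Suc i)) (rho (omit i ys) (rho (xs @ [ys ! i]) w)))"

definition commutator_bracket ::
  "('k::field \<Rightarrow> 'v::ab_group_add \<Rightarrow> 'v) \<Rightarrow> nat \<Rightarrow> ('v list \<Rightarrow> 'v) \<Rightarrow> 'v list \<Rightarrow> 'v" where
  "commutator_bracket scale n pr xs =
    (\<Sum>i<n. scale ((-1) ^ (n - Suc i)) (pr (omit i xs @ [xs ! i])))"

locale n_pre_lie_algebra = fd_vector_space scale
  for scale :: "'k::{alg_closed_field, field_char_0} \<Rightarrow> 'v::ab_group_add \<Rightarrow> 'v" +
  fixes n :: nat
    and pr :: "'v list \<Rightarrow> 'v"
  assumes n_ge_2: "2 \<le> n"
    and pr_multilinear: "multilinear_map scale scale n pr"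
    and pr_skew: "\<And>z. skew_symmetric (n - 1) (\<lambda>xs. pr (xs @ [z]))"
    and pr_pr:
      "\<And>xs ys z. length xs = n - 1 \<Longrightarrow> length ys = n - 1 \<Longrightarrow>
        pr (xs @ [pr (ys @ [z])]) =
          (\<Sum>i<n - 1. pr (ys[i := commutator_bracket scale n pr (xs @ [ys ! i])] @ [z]))
          + pr (ys @ [pr (xs @ [z])])"
    and pr_commutator:
      "\<And>xs ys. length xs = n - 1 \<Longrightarrow> length ys = n \<Longrightarrow>
        pr (commutator_bracket scale n pr ys # xs) =
          (\<Sum>i<n. scale ((-1) ^ (n - Suc i)) (pr (omit i ys @ [pr ((ys ! i) # xs)])))"

definition left_mult :: "('v list \<Rightarrow> 'v) \<Rightarrow> 'v list \<Rightarrow> 'v \<Rightarrow> 'v" where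
  "left_mult pr xs z = pr (xs @ [z])"

end

theory Submission
  imports Defs
begin

text \<open>
  Write \<open>L(X)\<close> for left multiplication and \<open>C\<close> for the commutator bracket. The two conditions on
  a representation are the two axioms of an \<open>n\<close>-pre-Lie algebra read as statements about the
  operators \<open>L(X)\<close>: the first axiom is the formula for \<open>[L(X), L(Y)]\<close> (\<open>left_mult_commutator\<close>),
  the second is the formula for \<open>L\<close> at a bracket, up to the position of the bracket among the
  skew-symmetric arguments (\<open>left_mult_bracket\<close>).

  A representation presupposes an \<open>n\<close>-Lie algebra, so the real content is that \<open>C\<close> is an
  \<open>n\<close>-Lie bracket. Multilinearity and skew-symmetry (\<open>bracket_multilinear\<close>, \<open>bracket_skew\<close>) hold
  because \<open>C\<close> is the alternating sum of \<open>L\<close> over the choice of the distinguished entry. For the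
  fundamental identity (\<open>bracket_fundamental_identity\<close>), the term \<open>L(X) C(Y)\<close> of
  \<open>C(X, C(Y))\<close> is expanded with the commutator formula, and the remaining terms, in which \<open>C(Y)\<close>
  is an argument of \<open>L\<close>, with the bracket formula. With \<open>Y\<^sub>i\<close> denoting \<open>Y\<close> without \<open>y\<^sub>i\<close>, the
  summands headed by \<open>L(Y\<^sub>i)\<close> recombine to \<open>L(Y\<^sub>i) C(X, y\<^sub>i)\<close>; the others have \<open>C(X, -)\<close> applied to
  an entry of \<open>Y\<^sub>i\<close>. Together they are the expansion of the sum of \<open>C\<close> over all ways of
  applying \<open>C(X, -)\<close> to one entry of \<open>Y\<close>.
\<close>

section \<open>Deleting an entry of a tuple\<close>

lemma length_omit: "i < length xs \<Longrightarrow> length (omit i xs) = length xs - 1"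
  by (simp add: omit_def)

lemma nth_omit:
  assumes "i < length xs" "l < length xs - 1"
  shows "omit i xs ! l = xs ! (if l < i then l else Suc l)"
  using assms by (auto simp: omit_def nth_append)

lemma omit_list_update_same: "i < length xs \<Longrightarrow> omit i (xs[i := x]) = omit i xs"
  by (simp add: omit_def)

lemma omit_list_update_other:
  assumes "k < length xs" "i < length xs" "i \<noteq> k"
  shows "omit k (xs[i := x]) = (omit k xs)[if i < k then i else i - 1 := x]"
  using assms
  by (intro nth_equalityI) (auto simp: length_omit nth_omit nth_list_update)

lemma omit_append_left: "k < length as \<Longrightarrow> omit k (as @ bs) = omit k as @ bs"
  by (simp add: omit_def)

section \<open>Skew-symmetric maps\<close>

lemma skew_symmetric_adjacent:
  assumes "skew_symmetric m f" "length as + length bs + 2 = m"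
  shows "f (as @ a # b # bs) = - f (as @ b # a # bs)"
proof -
  let ?xs = "as @ b # a # bs" and ?i = "length as"
  have "f (?xs[?i := ?xs ! Suc ?i, Suc ?i := ?xs ! ?i]) = - f ?xs"
    using assms(1)[unfolded skew_symmetric_def, rule_format, of ?xs ?i "Suc ?i"] assms(2)
    by simp
  then show ?thesis
    by (simp add: list_update_append nth_append)
qed

text \<open>
  Adjacent transpositions suffice: two entries separated by a block can be exchanged by
  carrying both of them past the first entry of the block and recursing.
\<close>

lemma skew_symmetricI_adjacent:
  assumes adj: "\<And>as a b bs. length as + length bs + 2 = m \<Longrightarrow>
    f (as @ a # b # bs) = - f (as @ b # a # bs)"
  shows "skew_symmetric m f"
proof -
  have swap: "f (as @ a # bs @ b # cs) = - f (as @ b # bs @ a # cs)"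
    if "length as + length bs + length cs + 2 = m" for as a bs b cs
    using that
  proof (induction bs arbitrary: as)
    case Nil
    then show ?case using adj[of as cs a b] by simp
  next
    case (Cons c bs)
    have "f (as @ a # c # bs @ b # cs) = - f (as @ c # a # bs @ b # cs)"
      using Cons.prems by (intro adj) simp
    also have "\<dots> = f (as @ c # b # bs @ a # cs)"
      using Cons.IH[of "as @ [c]"] Cons.prems by simp
    also have "\<dots> = - f (as @ b # c # bs @ a # cs)"
      using Cons.prems by (intro adj) simp
    finally show ?case by simp
  qed
  have lt: "f (xs[i := xs ! j, j := xs ! i]) = - f xs"
    if "length xs = m" "i < j" "j < m" for xs i j
  proof -
    define as bs cs u v where "as = take i xs" and "bs = take (j - Suc i) (drop (Suc i) xs)"
      and "cs = drop (Suc j) xs" and u: "u = xs ! i" and v: "v = xs ! j"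
    note defs = this
    have "drop (Suc i) xs = bs @ drop j xs"
      using append_take_drop_id[of "j - Suc i" "drop (Suc i) xs"] that by (simp add: defs)
    moreover have "drop j xs = v # cs"
      using that by (simp add: defs Cons_nth_drop_Suc)
    moreover have "xs = as @ u # drop (Suc i) xs"
      using that id_take_nth_drop[of i xs] by (simp add: defs)
    ultimately have xs: "xs = as @ u # bs @ v # cs"
      by simp
    have i: "i = length as" and j: "j = length as + Suc (length bs)"
      using that by (auto simp: defs)
    have "xs[i := v, j := u] = as @ v # bs @ u # cs"
      unfolding i j by (subst xs) (simp add: list_update_append)
    moreover have "length as + length bs + length cs + 2 = m"
      using that by (auto simp: defs)
    ultimately show ?thesis
      using swap[of as bs cs v u] unfolding u[symmetric] v[symmetric] by (simp flip: xs)
  qed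
  show ?thesis
    unfolding skew_symmetric_def
  proof (intro allI impI)
    fix xs :: "'a list" and i j
    assume "length xs = m" "i < m" "j < m" "i \<noteq> j"
    then show "f (xs[i := xs ! j, j := xs ! i]) = - f xs"
      using lt[of xs i j] lt[of xs j i] by (cases "i < j") (auto simp: list_update_swap)
  qed
qed

lemma (in module) skew_symmetric_move:
  assumes "skew_symmetric m f" "length as + length bs + length cs + 1 = m"
  shows "f (as @ x # bs @ cs) = scale ((-1) ^ length bs) (f (as @ bs @ x # cs))"
  using assms(2)
proof (induction bs arbitrary: as)
  case Nil
  then show ?case by simp
next
  case (Cons b bs)
  have "f (as @ x # b # bs @ cs) = - f (as @ b # x # bs @ cs)"
    using Cons.prems by (intro skew_symmetric_adjacent[OF assms(1)]) simp
  then show ?case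
    using Cons.IH[of "as @ [b]"] Cons.prems by simp
qed

section \<open>The commutator bracket\<close>

context n_pre_lie_algebra
begin

abbreviation C :: "'v list \<Rightarrow> 'v" where "C \<equiv> commutator_bracket scale n pr"

lemma left_mult_linear:
  assumes "length xs = n - 1"
  shows "Vector_Spaces.linear scale scale (left_mult pr xs)"
proof -
  have "Vector_Spaces.linear scale scale (\<lambda>x. pr ((xs @ [0])[n - 1 := x]))"
    using pr_multilinear assms n_ge_2 unfolding multilinear_map_def by simp
  then show ?thesis
    using assms by (simp add: left_mult_def[abs_def] list_update_append)
qed

lemma left_mult_multilinear:
  "multilinear_map scale scale (n - 1) (\<lambda>xs. left_mult pr xs w)"
  unfolding multilinear_map_def
proof (intro allI impI)
  fix xs :: "'v list" and i
  assume *: "length xs = n - 1" "i < n - 1"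
  have "Vector_Spaces.linear scale scale (\<lambda>x. pr ((xs @ [w])[i := x]))"
    using pr_multilinear * unfolding multilinear_map_def by simp
  then show "Vector_Spaces.linear scale scale (\<lambda>x. left_mult pr (xs[i := x]) w)"
    using * by (simp add: left_mult_def list_update_append)
qed

lemma left_mult_skew: "skew_symmetric (n - 1) (\<lambda>xs. left_mult pr xs w)"
  using pr_skew by (simp add: left_mult_def)

lemma left_mult_commutator:
  assumes "length xs = n - 1" "length ys = n - 1"
  shows "left_mult pr xs (left_mult pr ys w) =
    (\<Sum>i<n - 1. left_mult pr (ys[i := C (xs @ [ys ! i])]) w)
    + left_mult pr ys (left_mult pr xs w)"
  using pr_pr[OF assms] by (simp add: left_mult_def)

text \<open>
  The axiom has the bracket in the first slot, a representation has it in the last. Cycling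
  the first argument of \<open>L\<close> to the end costs the sign \<open>(-1)\<^sup>n\<^sup>-\<^sup>2\<close>, and it does so on both sides.
\<close>

lemma left_mult_bracket:
  assumes xs: "length xs = n - 2" and ys: "length ys = n"
  shows "left_mult pr (xs @ [C ys]) w =
    (\<Sum>i<n. scale ((-1) ^ (n - Suc i)) (left_mult pr (omit i ys) (left_mult pr (xs @ [ys ! i]) w)))"
proof -
  interpret vector_space_pair scale scale ..
  let ?s = "(-1) ^ (n - 2) :: 'k"
  have cyc: "left_mult pr (xs @ [x]) w = scale ?s (left_mult pr (x # xs) w)" for x
    using skew_symmetric_move[OF left_mult_skew, of "[]" xs "[]" x w] xs n_ge_2
    by (simp flip: power_mult_distrib)
  have "left_mult pr (xs @ [C ys]) w = scale ?s (pr (C ys # (xs @ [w])))"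
    unfolding cyc by (simp add: left_mult_def)
  also have "\<dots> = scale ?s (\<Sum>i<n. scale ((-1) ^ (n - Suc i))
      (left_mult pr (omit i ys) (left_mult pr ((ys ! i) # xs) w)))"
    using pr_commutator[of "xs @ [w]" ys] xs ys n_ge_2 by (simp add: left_mult_def)
  also have "\<dots> = (\<Sum>i<n. scale ((-1) ^ (n - Suc i))
      (left_mult pr (omit i ys) (left_mult pr (xs @ [ys ! i]) w)))"
  proof -
    have "left_mult pr (omit i ys) (left_mult pr (xs @ [ys ! i]) w) =
      scale ?s (left_mult pr (omit i ys) (left_mult pr ((ys ! i) # xs) w))" if "i < n" for i
      using left_mult_linear[of "omit i ys"] that ys
      by (simp add: cyc length_omit linear_scale)
    then show ?thesis
      by (simp add: scale_sum_right mult.commute)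
  qed
  finally show ?thesis .
qed

lemma bracket_eq:
  "C xs = (\<Sum>i<n. scale ((-1) ^ (n - Suc i)) (left_mult pr (omit i xs) (xs ! i)))"
  by (simp add: commutator_bracket_def left_mult_def)

lemma bracket_snoc:
  assumes "length xs = n - 1"
  shows "C (xs @ [z]) = left_mult pr xs z +
    (\<Sum>j<n - 1. scale ((-1) ^ (n - Suc j)) (left_mult pr (omit j xs @ [z]) (xs ! j)))"
proof -
  obtain m where n: "n = Suc m"
    using n_ge_2 by (cases n) auto
  then have "length xs = m" using assms by simp
  then show ?thesis
    unfolding bracket_eq unfolding n
    by (auto simp: nth_append omit_append_left add.commute
        omit_def intro!: sum.cong)
qed

lemma bracket_multilinear: "multilinear_map scale scale n C"
  unfolding multilinear_map_def
proof (intro allI impI)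
  fix xs :: "'v list" and i
  assume xs: "length xs = n" and i: "i < n"
  interpret vector_space_pair scale scale ..
  have "Vector_Spaces.linear scale scale
      (\<lambda>x. left_mult pr (omit k (xs[i := x])) (xs[i := x] ! k))" if k: "k < n" for k
  proof (cases "k = i")
    case True
    then show ?thesis
      using left_mult_linear[of "omit i xs"] xs i
      by (simp add: omit_list_update_same length_omit)
  next
    case False
    let ?i = "if i < k then i else i - 1"
    have "?i < n - 1" "length (omit k xs) = n - 1"
      using i k xs False by (auto simp: length_omit)
    then have "Vector_Spaces.linear scale scale
        (\<lambda>x. left_mult pr ((omit k xs)[?i := x]) (xs ! k))"
      using left_mult_multilinear[of "xs ! k"] unfolding multilinear_map_def by blast
    then show ?thesis
      using xs i k False by (simp add: omit_list_update_other)
  qed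
  then show "Vector_Spaces.linear scale scale (\<lambda>x. C (xs[i := x]))"
    unfolding bracket_eq
    by (intro linear_compose_sum ballI linear_compose_scale_right) auto
qed

text \<open>
  Under a transposition of two neighbouring entries, the terms of \<open>C\<close> deleting one of these
  are interchanged and their signs differ by one; every other term contains both entries
  among the skew-symmetric arguments of \<open>L\<close>.
\<close>

lemma bracket_skew: "skew_symmetric n C"
proof (rule skew_symmetricI_adjacent)
  fix as bs :: "'v list" and a b
  assume len: "length as + length bs + 2 = n"
  let ?p = "length as" and ?xs = "as @ a # b # bs" and ?ys = "as @ b # a # bs"
  let ?q = "\<lambda>k. if k = ?p then Suc ?p else if k = Suc ?p then ?p else k"
  let ?t = "\<lambda>xs k. scale ((-1) ^ (n - Suc k)) (left_mult pr (omit k xs) (xs ! k))"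
  have t: "?t ?xs (?q k) = - ?t ?ys k" if k: "k < n" for k
  proof -
    consider "k < ?p" | "k = ?p" | "k = Suc ?p" | "Suc ?p < k" by linarith
    then show ?thesis
    proof cases
      case 1
      then show ?thesis
        using skew_symmetric_adjacent[OF left_mult_skew, of "omit k as" bs a b "as ! k"] len
        by (simp add: nth_append omit_append_left length_omit)
    next
      case 2
      have "n - Suc ?p = Suc (n - Suc (Suc ?p))" using len by simp
      then show ?thesis
        using 2 by (simp add: omit_def nth_append)
    next
      case 3
      have "n - Suc ?p = Suc (n - Suc (Suc ?p))" using len by simp
      then show ?thesis
        using 3 by (simp add: omit_def nth_append)
    next
      case 4
      define l where "l = k - ?p - 2"
      have k: "k = ?p + Suc (Suc l)" and l: "l < length bs"
        using 4 k len by (auto simp: l_def)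
      have om: "omit k (as @ u # v # bs) = as @ u # v # omit l bs" for u v
        by (simp add: k omit_def numeral_3_eq_3)
      have nt: "(as @ u # v # bs) ! k = bs ! l" for u v
        by (simp add: k nth_append)
      show ?thesis
        using skew_symmetric_adjacent[OF left_mult_skew, of as "omit l bs" a b "bs ! l"] len l 4
        by (simp add: om nt length_omit)
    qed
  qed
  have "bij_betw ?q {..<n} {..<n}"
    by (rule bij_betw_byWitness[of _ ?q]) (use len in auto)
  then have "C ?xs = (\<Sum>k<n. ?t ?xs (?q k))"
    unfolding bracket_eq by (rule sum.reindex_bij_betw[symmetric])
  also have "\<dots> = (\<Sum>k<n. - ?t ?ys k)"
    by (rule sum.cong[OF refl]) (rule t, simp)
  also have "\<dots> = - C ?ys"
    unfolding bracket_eq by (rule sum_negf)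
  finally show "C ?xs = - C ?ys" .
qed

text \<open>
  The Leibniz-type sum on the right of the fundamental identity, sorted by the distinguished
  entry \<open>y\<^sub>i\<close> of each \<open>C\<close>: the map \<open>g\<close> hits either \<open>y\<^sub>i\<close> itself or one of the arguments of \<open>L\<close>.
\<close>

lemma sum_bracket_update:
  assumes ys: "length ys = n"
  shows "(\<Sum>j<n. C (ys[j := g (ys ! j)])) =
    (\<Sum>i<n. scale ((-1) ^ (n - Suc i))
      (left_mult pr (omit i ys) (g (ys ! i)) +
       (\<Sum>l<n - 1. left_mult pr ((omit i ys)[l := g (omit i ys ! l)]) (ys ! i))))"
proof -
  have inner: "(\<Sum>j<n. left_mult pr (omit i (ys[j := g (ys ! j)])) (ys[j := g (ys ! j)] ! i)) =
      left_mult pr (omit i ys) (g (ys ! i)) +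
       (\<Sum>l<n - 1. left_mult pr ((omit i ys)[l := g (omit i ys ! l)]) (ys ! i))"
    (is "sum ?f _ = _ + ?S") if i: "i < n" for i
  proof -
    \<comment> \<open>For \<open>j \<noteq> i\<close>, the position \<open>j\<close> of \<open>ys\<close> becomes \<open>j\<close> or \<open>j - 1\<close> in \<open>omit i ys\<close>.\<close>
    have "sum ?f {..<n} = ?f i + sum ?f ({..<n} - {i})"
      using i by (simp add: sum.remove)
    also have "?f i = left_mult pr (omit i ys) (g (ys ! i))"
      using i ys by (simp add: omit_list_update_same)
    also have "sum ?f ({..<n} - {i}) = ?S"
      by (rule sum.reindex_bij_witness[of _ "\<lambda>l. if l < i then l else Suc l"
            "\<lambda>j. if j < i then j else j - 1"])
        (use i ys in \<open>auto simp: omit_list_update_other nth_omit split: if_splits\<close>)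
    finally show ?thesis .
  qed
  have "(\<Sum>j<n. C (ys[j := g (ys ! j)])) = (\<Sum>i<n. scale ((-1) ^ (n - Suc i))
      (\<Sum>j<n. left_mult pr (omit i (ys[j := g (ys ! j)])) (ys[j := g (ys ! j)] ! i)))"
    unfolding bracket_eq scale_sum_right by (rule sum.swap)
  then show ?thesis
    by (simp only:) (intro sum.cong refl, simp only: inner lessThan_iff)
qed

text \<open>
  In the double sum coming from \<open>left_mult_bracket\<close>, the inner sum over the entries of \<open>xs\<close> is
  exactly what \<open>L(X) y\<^sub>i\<close> lacks to be \<open>C(X, y\<^sub>i)\<close> (\<open>bracket_snoc\<close>), and \<open>L(Y\<^sub>i) L(X) y\<^sub>i\<close> is supplied
  by the commutator formula.
\<close>

lemma bracket_fundamental_identity: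
  assumes xs: "length xs = n - 1" and ys: "length ys = n"
  shows "C (xs @ [C ys]) = (\<Sum>i<n. C (ys[i := C (xs @ [ys ! i])]))"
proof -
  interpret vector_space_pair scale scale ..
  let ?L = "left_mult pr"
  let ?e = "\<lambda>i. (-1) ^ (n - Suc i) :: 'k"
  let ?S = "\<lambda>i. \<Sum>j<n - 1. scale (?e j) (?L (omit j xs @ [ys ! i]) (xs ! j))"
  have lin: "Vector_Spaces.linear scale scale (?L (omit i ys))" if "i < n" for i
    using that ys by (intro left_mult_linear) (simp add: length_omit)
  have LX: "?L xs (C ys) = (\<Sum>i<n. scale (?e i)
      (?L (omit i ys) (?L xs (ys ! i)) +
       (\<Sum>l<n - 1. ?L ((omit i ys)[l := C (xs @ [omit i ys ! l])]) (ys ! i))))"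
    using left_mult_linear[OF xs] xs ys
    by (simp add: bracket_eq[of ys] linear_sum linear_scale left_mult_commutator[OF xs] length_omit
        add.commute)
  have LY: "?L (omit j xs @ [C ys]) (xs ! j) =
      (\<Sum>i<n. scale (?e i) (?L (omit i ys) (?L (omit j xs @ [ys ! i]) (xs ! j))))"
    if "j < n - 1" for j
    using that xs ys by (intro left_mult_bracket) (auto simp: length_omit)
  have rest: "(\<Sum>j<n - 1. scale (?e j) (?L (omit j xs @ [C ys]) (xs ! j))) =
      (\<Sum>i<n. scale (?e i) (?L (omit i ys) (?S i)))"
  proof -
    have "(\<Sum>j<n - 1. scale (?e j) (?L (omit j xs @ [C ys]) (xs ! j))) =
        (\<Sum>j<n - 1. \<Sum>i<n. scale (?e i)
          (scale (?e j) (?L (omit i ys) (?L (omit j xs @ [ys ! i]) (xs ! j)))))"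
      by (intro sum.cong refl)
        (simp only: LY lessThan_iff scale_sum_right scale_left_commute)
    also have "\<dots> = (\<Sum>i<n. \<Sum>j<n - 1. scale (?e i)
          (scale (?e j) (?L (omit i ys) (?L (omit j xs @ [ys ! i]) (xs ! j)))))"
      by (rule sum.swap)
    finally show ?thesis
      by (simp add: lin linear_sum linear_scale scale_sum_right)
  qed
  have recombine: "?L (omit i ys) (C (xs @ [ys ! i])) =
      ?L (omit i ys) (?L xs (ys ! i)) + ?L (omit i ys) (?S i)" if "i < n" for i
    unfolding bracket_snoc[OF xs] by (rule linear_add[OF lin[OF that]])
  have "C (xs @ [C ys]) = (\<Sum>i<n. scale (?e i)
      (?L (omit i ys) (C (xs @ [ys ! i])) +
       (\<Sum>l<n - 1. ?L ((omit i ys)[l := C (xs @ [omit i ys ! l])]) (ys ! i))))"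
    unfolding bracket_snoc[OF xs, of "C ys"] LX rest sum.distrib[symmetric]
      scale_right_distrib[symmetric]
    by (intro sum.cong refl) (simp only: recombine lessThan_iff add.assoc add.commute
        add.left_commute)
  also have "\<dots> = (\<Sum>i<n. C (ys[i := C (xs @ [ys ! i])]))"
    using sum_bracket_update[OF ys, of "\<lambda>y. C (xs @ [y])"] by simp
  finally show ?thesis .
qed

end

section \<open>The left multiplication representation\<close>

theorem proposition3p16:
  fixes scale :: "'k::{alg_closed_field, field_char_0} \<Rightarrow> 'v::ab_group_add \<Rightarrow> 'v"
    and n :: nat
    and pr :: "'v list \<Rightarrow> 'v"
  assumes "n_pre_lie_algebra scale n pr"
  shows "n_lie_representation scale n (commutator_bracket scale n pr) scale (left_mult pr)"
proof -
  interpret n_pre_lie_algebra scale n pr by (rule assms)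
  have fd: "fd_vector_space scale" ..
  show ?thesis
  proof (intro n_lie_representation.intro n_lie_algebra.intro n_lie_algebra_axioms.intro
      n_lie_representation_axioms.intro)
    show "left_mult pr xs (left_mult pr ys w) - left_mult pr ys (left_mult pr xs w) =
        (\<Sum>i<n - 1. left_mult pr (ys[i := C (xs @ [ys ! i])]) w)"
      if "length xs = n - 1" "length ys = n - 1" for xs ys w
      by (subst left_mult_commutator[OF that]) simp
  qed (rule fd n_ge_2 bracket_multilinear bracket_skew bracket_fundamental_identity
      left_mult_linear left_mult_multilinear left_mult_skew left_mult_bracket; assumption)+
qed

end
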